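(* Let $X$ be a connected metric space that contains a copy of the circle $\mathbb{S}^1$ (that is, a subspace homeomorphic to $\mathbb{S}^1$). Then the only radial order on $X$ is the trivial order.
   Context: For a partial order $\succcurlyeq$ (reflexive, transitive, antisymmetric relation) on $X$: $x\succ y$ means $x\succcurlyeq y$ and $x\neq y$; $x\succcurlyeq^{\bullet}y$ means that $y\succcurlyeq x$ does not hold. The trivial order is the equality relation. A partial order $\succcurlyeq$ on a metric space $(X,d)$ is radial if for all $x,y,z\in X$: (i) $x\succcurlyeq^{\bullet}y\succ z$ implies $d(x,z)\geq d(x,y)$; and (ii) $x\succ y\succcurlyeq^{\bullet}z$ implies $d(x,z)\geq d(y,z)$. *)

theory Defs
  imports "HOL-Analysis.Analysis"
begin

text \<open>
  An order \<open>r\<close> on \<open>X\<close> is given as a relation in which \<open>(x, y) \<in> r\<close> is read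
  \<open>x \<succcurlyeq> y\<close>, so the larger element comes first.
\<close>

definition ord_gt :: "'a rel \<Rightarrow> 'a \<Rightarrow> 'a \<Rightarrow> bool" where
  "ord_gt r x y \<longleftrightarrow> (x, y) \<in> r \<and> x \<noteq> y"

text \<open>The relation \<open>x \<succcurlyeq>\<^sup>\<bullet> y\<close>: \<open>x\<close> is not below \<open>y\<close>, though the two may be incomparable.\<close>

definition ord_ge_dot :: "'a rel \<Rightarrow> 'a \<Rightarrow> 'a \<Rightarrow> bool" where
  "ord_ge_dot r x y \<longleftrightarrow> (y, x) \<notin> r"

definition radial_order_on :: "'a set \<Rightarrow> ('a \<Rightarrow> 'a \<Rightarrow> real) \<Rightarrow> 'a rel \<Rightarrow> bool" where
  "radial_order_on X d r \<longleftrightarrow>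
     partial_order_on X r \<and>
     (\<forall>x\<in>X. \<forall>y\<in>X. \<forall>z\<in>X.
        (ord_ge_dot r x y \<and> ord_gt r y z \<longrightarrow> d x z \<ge> d x y) \<and>
        (ord_gt r x y \<and> ord_ge_dot r y z \<longrightarrow> d x z \<ge> d y z))"

end

theory Submission
  imports Defs
begin

text \<open>
  The conditions (i) and (ii) in the definition of a radial order control the topology of the order.
  If \<open>x \<succ> y\<close>, then (ii) forces every point \<open>w\<close> closer to \<open>x\<close> than to \<open>y\<close> to lie above \<open>y\<close>, and it keeps
  every point that is not above \<open>y\<close> at least as far from \<open>x\<close> as from \<open>y\<close>. Hence the strict upper set
  of \<open>y\<close> is open, and it is closed in the space without \<open>y\<close>. Reversing the order exchanges (i)
  and (ii), so the same holds for strict lower sets. Two consequences follow. A connected set that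
  avoids \<open>y\<close> and meets one of the two strict sets of \<open>y\<close> lies inside it
  (\<open>connectedin_subset_strict_upper\<close>, \<open>connectedin_subset_strict_lower\<close>). And in a connected space a
  nonempty strict upper set of \<open>y\<close> accumulates at \<open>y\<close>, as otherwise it would be clopen
  (\<open>strict_upper_accumulates\<close>).

  Let \<open>S\<close> be the circle. It has more than two points and stays connected when any point is removed.
  If \<open>u \<succ> v\<close> in \<open>S\<close>, then any third point \<open>w\<close> of \<open>S\<close> lies strictly between \<open>v\<close> and \<open>u\<close>, so the
  connected set \<open>S - {w}\<close> meets both the upper and the lower set of \<open>w\<close>, which is impossible: \<open>S\<close> is
  an antichain. If some \<open>x \<succ> p\<close> with \<open>p \<in> S\<close>, take such an \<open>x\<close> very close to \<open>p\<close>. It lies outside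
  \<open>S\<close>, so all of \<open>S\<close> lies below it, and (ii) bounds \<open>d x p\<close> from below by \<open>d q p\<close> for every other
  point \<open>q\<close> of \<open>S\<close>, a contradiction. So the points of \<open>S\<close> are isolated in the order: each is comparable
  only to itself (\<open>no_cut_points_imp_maximal\<close>, for the order and its converse).

  It remains to see that one such isolated point makes the whole order trivial
  (\<open>isolated_point_imp_no_strict_pair\<close>). The two radial conditions give \<open>d p x = d p y\<close> whenever
  \<open>x \<succ> y\<close> and \<open>p\<close> is isolated. Hence, along a chain of comparabilities, the distances to all isolated
  points stay constant. The set of points that have the same distances to the isolated points as
  a given non-isolated point is then clopen and misses the isolated points, against connectedness.
\<close>

section \<open>Duality\<close>

text \<open>Reversing the order turns each of the two radial conditions into the other, by symmetry of
  the distance.\<close>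
lemma radial_order_on_converse:
  assumes "Metric_space X d" and "radial_order_on X d r"
  shows "radial_order_on X d (r\<inverse>)"
proof -
  have "partial_order_on X (r\<inverse>)"
    using assms(2) by (auto simp: radial_order_on_def)
  moreover have "d x y = d y x" for x y
    using assms(1) by (rule Metric_space.commute)
  ultimately show ?thesis
    using assms(2) unfolding radial_order_on_def ord_ge_dot_def ord_gt_def
    by (metis converse_iff)
qed

section \<open>The circle has no cut points\<close>

lemma connected_punctured_circle:
  fixes z :: complex
  shows "connected (sphere 0 1 - {z})"
proof (cases "z \<in> sphere 0 1")
  case True
  then have "(sphere (0::complex) 1 - {z}) homeomorphic {x. (1::complex) \<bullet> x = 0}"
    by (intro homeomorphic_punctured_sphere_hyperplane) auto
  moreover have "connected {x. (1::complex) \<bullet> x = 0}"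
    by (intro convex_connected convex_hyperplane)
  ultimately show ?thesis
    using homeomorphic_connectedness by blast
next
  case False
  then show ?thesis
    by (simp add: connected_sphere)
qed

lemma circle_copy_no_cut_points:
  assumes "subtopology T S homeomorphic_space top_of_set (sphere (0::complex) 1)"
    and "S \<subseteq> topspace T"
  shows "connectedin T (S - {y})" and "infinite S"
proof -
  obtain f g where fg: "homeomorphic_maps (top_of_set (sphere (0::complex) 1)) (subtopology T S) f g"
    using assms(1) homeomorphic_space_sym homeomorphic_space_def by blast
  then have cont: "continuous_map (top_of_set (sphere 0 1)) (subtopology T S) f"
    by (simp add: homeomorphic_maps_def)
  have im: "f ` sphere 0 1 = S" and inj: "inj_on f (sphere 0 1)"
    using homeomorphic_imp_surjective_map[OF homeomorphic_maps_imp_map[OF fg]]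
      homeomorphic_imp_injective_map[OF homeomorphic_maps_imp_map[OF fg]] assms(2)
    by (auto simp: inf_absorb2)
  \<comment> \<open>A finite connected set has at most one point.\<close>
  have "infinite (sphere (0::complex) 1)"
  proof
    assume "finite (sphere (0::complex) 1)"
    then obtain z where "sphere (0::complex) 1 = {z}"
      using connected_finite_iff_sing[OF connected_sphere[of "0::complex" 1]] by auto
    moreover have "1 \<in> sphere (0::complex) 1" "- 1 \<in> sphere (0::complex) 1"
      by auto
    ultimately have "(1::complex) = - 1"
      by (metis singletonD)
    then show False
      by simp
  qed
  then show "infinite S"
    using im inj finite_imageD by blast
  obtain z where "S - {y} = f ` (sphere 0 1 - {z})"
  proof (cases "y \<in> S")
    case True
    then obtain z where "z \<in> sphere 0 1" "y = f z"
      using im by blast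
    then have "S - {y} = f ` (sphere 0 1 - {z})"
      using im inj by (auto simp: inj_on_def)
    then show ?thesis
      by (rule that)
  next
    case False
    then show ?thesis
      using im that[of 0] by auto
  qed
  moreover have "connectedin (top_of_set (sphere 0 1)) (sphere 0 1 - {z})"
    using connected_punctured_circle[of z] by (simp add: connectedin_subtopology)
  ultimately show "connectedin T (S - {y})"
    using connectedin_continuous_map_image[OF cont] connectedin_subtopology by metis
qed

section \<open>Strict upper and lower sets of a point\<close>

context Metric_space
begin

text \<open>By condition (ii), a point closer to \<open>x\<close> than to \<open>y\<close> is above \<open>y\<close> as soon as \<open>x\<close> is; the ball
  of radius \<open>d x y / 2\<close> around \<open>x\<close> consists of such points.\<close>
lemma openin_strict_upper:
  assumes "radial_order_on M d r"
  shows "openin mtopology {x. ord_gt r x y}"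
  unfolding openin_mtopology
proof (intro conjI allI impI)
  have sub: "r \<subseteq> M \<times> M"
    using assms by (auto simp: radial_order_on_def order_on_defs)
  then show "{x. ord_gt r x y} \<subseteq> M"
    by (auto simp: ord_gt_def)
  fix x assume "x \<in> {x. ord_gt r x y}"
  then have xy: "ord_gt r x y" "x \<in> M" "y \<in> M" "x \<noteq> y"
    using sub by (auto simp: ord_gt_def)
  have "ord_gt r w y" if w: "w \<in> mball x (d x y / 2)" for w
  proof -
    have wM: "w \<in> M" and near: "d x w < d x y / 2"
      using w by auto
    then have "d x w < d y w"
      using triangle[of x w y] xy commute[of w y] by simp
    then have "(w, y) \<in> r"
      using assms xy wM by (fastforce simp: radial_order_on_def ord_ge_dot_def)
    moreover have "w \<noteq> y"
      using near nonneg[of x y] by (smt (verit) field_sum_of_halves)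
    ultimately show ?thesis
      by (simp add: ord_gt_def)
  qed
  then show "\<exists>\<epsilon>>0. mball x \<epsilon> \<subseteq> {x. ord_gt r x y}"
    using xy by (intro exI[of _ "d x y / 2"]) auto
qed

text \<open>This says that the strict upper set of \<open>y\<close> has no limit point outside itself except \<open>y\<close>.
  If \<open>w\<close> is not above \<open>y\<close>, then condition (ii) reads \<open>d x w \<ge> d y w\<close> for all \<open>x \<succ> y\<close>, so the ball of
  radius \<open>d y w\<close> around \<open>w\<close> contains no such \<open>x\<close>.\<close>
lemma openin_not_weak_upper:
  assumes "radial_order_on M d r" and "y \<in> M"
  shows "openin mtopology {w \<in> M. (w, y) \<notin> r}"
  unfolding openin_mtopology
proof (intro conjI allI impI)
  fix w assume w: "w \<in> {w \<in> M. (w, y) \<notin> r}"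
  have "(y, y) \<in> r"
    using assms by (auto simp: radial_order_on_def order_on_defs refl_on_def)
  then have pos: "d y w > 0"
    using w assms by auto
  have "(x, y) \<notin> r" if x: "x \<in> mball w (d y w)" for x
  proof
    assume "(x, y) \<in> r"
    moreover have "x \<noteq> y"
      using x commute[of w x] by auto
    ultimately have "d x w \<ge> d y w"
      using assms w x by (auto simp: radial_order_on_def ord_ge_dot_def ord_gt_def)
    then show False
      using x commute[of w x] by simp
  qed
  then show "\<exists>\<epsilon>>0. mball w \<epsilon> \<subseteq> {w \<in> M. (w, y) \<notin> r}"
    using pos by (intro exI[of _ "d y w"]) auto
qed auto

text \<open>The two open sets above are disjoint and cover everything but \<open>y\<close>.\<close>
lemma connectedin_subset_strict_upper:
  assumes "radial_order_on M d r" and "connectedin mtopology C"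
    and "y \<notin> C" and "x \<in> C" and "ord_gt r x y"
  shows "C \<subseteq> {w. ord_gt r w y}"
proof -
  have "y \<in> M"
    using assms by (auto simp: radial_order_on_def order_on_defs ord_gt_def)
  have CM: "C \<subseteq> M"
    using assms(2) connectedin_subset_topspace by fastforce
  have "C \<inter> {w \<in> M. (w, y) \<notin> r} = {}"
    using connectedinD[OF assms(2) openin_strict_upper[OF assms(1)]
        openin_not_weak_upper[OF assms(1) \<open>y \<in> M\<close>]] assms CM
    by (fastforce simp: ord_gt_def)
  then show ?thesis
    using CM assms(3) by (auto simp: ord_gt_def)
qed

lemma connectedin_subset_strict_lower:
  assumes "radial_order_on M d r" and "connectedin mtopology C"
    and "y \<notin> C" and "x \<in> C" and "ord_gt r y x"
  shows "C \<subseteq> {w. ord_gt r y w}"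
proof -
  have "radial_order_on M d (r\<inverse>)"
    using assms(1) Metric_space_axioms radial_order_on_converse by blast
  then show ?thesis
    using connectedin_subset_strict_upper[of "r\<inverse>" C y x] assms by (auto simp: ord_gt_def)
qed

text \<open>If the strict upper set stayed away from \<open>y\<close>, it would be a clopen set that is neither empty
  nor the whole space.\<close>
lemma strict_upper_accumulates:
  assumes "radial_order_on M d r" and "connected_space mtopology"
    and "ord_gt r x y" and "\<epsilon> > 0"
  obtains x' where "ord_gt r x' y" and "d x' y < \<epsilon>"
proof -
  define U where "U = {x. ord_gt r x y}"
  have sub: "r \<subseteq> M \<times> M"
    using assms(1) by (auto simp: radial_order_on_def order_on_defs)
  then have y: "y \<in> M"
    using assms(3) by (auto simp: ord_gt_def)
  have "\<exists>x'. ord_gt r x' y \<and> d x' y < \<epsilon>"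
  proof (rule ccontr)
    assume far: "\<not> ?thesis"
    have "M - U = {w \<in> M. (w, y) \<notin> r} \<union> mball y \<epsilon>"
      using far y \<open>\<epsilon> > 0\<close> by (auto simp: U_def ord_gt_def commute)
    then have "openin mtopology (M - U)"
      using openin_not_weak_upper[OF assms(1) y] openin_mball by (simp add: openin_Un)
    moreover have "openin mtopology U"
      unfolding U_def by (rule openin_strict_upper[OF assms(1)])
    ultimately have "U = {} \<or> U = M"
      using assms(2) openin_subset[of mtopology U]
      by (auto simp: connected_space_clopen_in closedin_def)
    then show False
      using assms(3) y by (auto simp: U_def ord_gt_def)
  qed
  then show ?thesis
    using that by blast
qed

section \<open>Sets without cut points consist of isolated points\<close>

text \<open>If \<open>u \<succ> v\<close>, a third point \<open>w\<close> satisfies \<open>u \<succ> w \<succ> v\<close>. As \<open>S - {w}\<close> is connected and contains \<open>u\<close>,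
  it lies above \<open>w\<close>; but it also contains \<open>v\<close>.\<close>
lemma no_cut_points_imp_antichain:
  assumes rad: "radial_order_on M d r"
    and conn: "\<And>y. connectedin mtopology (S - {y})"
    and "infinite S" and "u \<in> S" and "v \<in> S"
  shows "\<not> ord_gt r u v"
proof
  assume uv: "ord_gt r u v"
  obtain w where w: "w \<in> S" "w \<noteq> u" "w \<noteq> v"
    using \<open>infinite S\<close> by (metis finite.emptyI finite_insert finite_subset insertCI subsetI)
  have "ord_gt r w v"
    using connectedin_subset_strict_upper[OF rad conn[of v], of v u] uv assms w
    by (auto simp: ord_gt_def)
  moreover have "ord_gt r u w"
    using connectedin_subset_strict_lower[OF rad conn[of u], of u v] uv assms w
    by (auto simp: ord_gt_def)
  then have "ord_gt r v w"
    using connectedin_subset_strict_upper[OF rad conn[of w], of w u] assms w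
    by (auto simp: ord_gt_def)
  ultimately show False
    using rad by (auto simp: radial_order_on_def order_on_defs ord_gt_def dest: antisymD)
qed

text \<open>A point \<open>x' \<succ> p\<close> close to \<open>p\<close> is above all of \<open>S\<close>. Since \<open>S\<close> is an antichain, condition (ii) then
  keeps \<open>x'\<close> at least as far from \<open>p\<close> as any other point \<open>q\<close> of \<open>S\<close> is.\<close>
lemma no_cut_points_imp_maximal:
  assumes rad: "radial_order_on M d r" and X: "connected_space mtopology"
    and conn: "\<And>y. connectedin mtopology (S - {y})"
    and "infinite S" and "p \<in> S"
  shows "\<not> ord_gt r x p"
proof
  assume "ord_gt r x p"
  obtain q where q: "q \<in> S" "q \<noteq> p"
    using \<open>infinite S\<close> by (metis finite.emptyI finite_insert finite_subset insertCI subsetI)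
  have SM: "S \<subseteq> M"
    using conn[of p, THEN connectedin_subset_topspace] conn[of q, THEN connectedin_subset_topspace] q
    by auto
  have anti: "\<not> ord_gt r u v" if "u \<in> S" "v \<in> S" for u v
    using no_cut_points_imp_antichain[OF rad conn] assms that by blast
  have "d q p > 0"
    using q SM \<open>p \<in> S\<close> by (intro mdist_pos_less) auto
  then obtain x' where x': "ord_gt r x' p" "d x' p < d q p"
    using strict_upper_accumulates[OF rad X \<open>ord_gt r x p\<close>] by blast
  have "x' \<notin> S"
    using anti x' \<open>p \<in> S\<close> by blast
  then have "S - {x'} = S"
    by blast
  then have "ord_gt r x' q"
    using connectedin_subset_strict_lower[OF rad conn[of x'], of x' p] x' q \<open>p \<in> S\<close> by auto
  moreover have "(p, q) \<notin> r"
    using anti[of p q] q \<open>p \<in> S\<close> by (auto simp: ord_gt_def)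
  moreover have "x' \<in> M"
    using rad x' by (auto simp: radial_order_on_def order_on_defs ord_gt_def)
  ultimately have "d x' p \<ge> d q p"
    using rad SM q \<open>p \<in> S\<close> by (auto simp: radial_order_on_def ord_ge_dot_def)
  then show False
    using x' by simp
qed

section \<open>One isolated point makes the order trivial\<close>

text \<open>Condition (i) gives \<open>d p y \<ge> d p x\<close>, and condition (ii) the reverse inequality.\<close>
lemma equidistant_from_incomparable:
  assumes "radial_order_on M d r" and "p \<in> M" and "ord_gt r x y"
    and "(x, p) \<notin> r" and "(p, y) \<notin> r"
  shows "d p x = d p y"
proof -
  have "x \<in> M" "y \<in> M"
    using assms by (auto simp: radial_order_on_def order_on_defs ord_gt_def)
  then have "d p y \<ge> d p x" "d x p \<ge> d y p"
    using assms by (auto simp: radial_order_on_def ord_ge_dot_def)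
  then show ?thesis
    by (simp add: commute)
qed

text \<open>For an alleged pair \<open>a \<succ> b\<close>, consider the set \<open>K\<close> of points with the same distances as \<open>a\<close> to the
  points of \<open>N\<close>, those comparable only to themselves. It is closed because distances are continuous. It is disjoint from \<open>N\<close>,
  since a point of both would have distance \<open>0\<close> from \<open>a\<close>, which is not in \<open>N\<close>. So each point of \<open>K\<close> is comparable
  to some other point \<open>y\<close>, and by equidistance the whole strict upper or lower set of \<open>y\<close>, an open
  set, lies in \<open>K\<close>.\<close>
lemma isolated_point_imp_no_strict_pair:
  assumes rad: "radial_order_on M d r" and X: "connected_space mtopology"
    and p: "p \<in> M" "\<And>x. \<not> ord_gt r x p" "\<And>x. \<not> ord_gt r p x"
  shows "\<not> ord_gt r a b"
proof
  assume ab: "ord_gt r a b"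
  define N where "N = {q \<in> M. \<forall>x. \<not> ord_gt r x q \<and> \<not> ord_gt r q x}"
  define K where "K = {z \<in> M. \<forall>q\<in>N. d q z = d q a}"
  have sub: "r \<subseteq> M \<times> M"
    using rad by (auto simp: radial_order_on_def order_on_defs)
  then have aM: "a \<in> M" and aN: "a \<notin> N"
    using ab by (auto simp: ord_gt_def N_def)
  have rad': "radial_order_on M d (r\<inverse>)"
    using rad Metric_space_axioms radial_order_on_converse by blast
  have equi: "d q x = d q y" if "q \<in> N" "ord_gt r x y" for q x y
  proof (rule equidistant_from_incomparable[OF rad])
    show "(x, q) \<notin> r" "(q, y) \<notin> r"
      using that by (auto simp: N_def ord_gt_def)
  qed (use that in \<open>auto simp: N_def\<close>)
  have KN: "K \<inter> N = {}"
  proof -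
    have "z = a" if "z \<in> K" "z \<in> N" for z
      using that aM zero[of z a] by (auto simp: K_def N_def)
    then show ?thesis
      using aN by blast
  qed
  have "\<exists>U. openin mtopology U \<and> z \<in> U \<and> U \<subseteq> K" if z: "z \<in> K" for z
  proof -
    have "z \<in> M" "z \<notin> N"
      using z KN by (auto simp: K_def)
    then consider y where "ord_gt r z y" | y where "ord_gt r y z"
      unfolding N_def by blast
    then show ?thesis
    proof cases
      case 1
      have "x \<in> K" if "ord_gt r x y" for x
      proof -
        have "d q x = d q z" if "q \<in> N" for q
          using equi[OF that 1] equi[OF that \<open>ord_gt r x y\<close>] by simp
        then show ?thesis
          using that z sub by (auto simp: K_def ord_gt_def)
      qed
      then have "{x. ord_gt r x y} \<subseteq> K"
        by blast
      then show ?thesis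
        using openin_strict_upper[OF rad, of y] 1 by blast
    next
      case 2
      have "x \<in> K" if "ord_gt r y x" for x
      proof -
        have "d q x = d q z" if "q \<in> N" for q
          using equi[OF that 2] equi[OF that \<open>ord_gt r y x\<close>] by simp
        then show ?thesis
          using that z sub by (auto simp: K_def ord_gt_def)
      qed
      then have "{x. ord_gt (r\<inverse>) x y} \<subseteq> K"
        by (auto simp: ord_gt_def)
      moreover have "z \<in> {x. ord_gt (r\<inverse>) x y}"
        using 2 by (auto simp: ord_gt_def)
      ultimately show ?thesis
        using openin_strict_upper[OF rad', of y] by blast
    qed
  qed
  then have "openin mtopology K"
    by (subst openin_subopen) blast
  moreover have "openin mtopology (M - K)"
    unfolding openin_mtopology
  proof (intro conjI allI impI)
    fix w assume w: "w \<in> M - K"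
    then obtain q where q: "q \<in> N" "d q w \<noteq> d q a"
      by (auto simp: K_def)
    have "v \<in> M - K" if v: "v \<in> mball w \<bar>d q w - d q a\<bar>" for v
    proof -
      have "\<bar>d q w - d q v\<bar> \<le> d w v"
        using mdist_reverse_triangle[of w q v] q v by (auto simp: N_def commute)
      then have "d q v \<noteq> d q a"
        using v by auto
      then show ?thesis
        using v q(1) by (auto simp: K_def)
    qed
    then show "\<exists>\<epsilon>>0. mball w \<epsilon> \<subseteq> M - K"
      using q by (intro exI[of _ "\<bar>d q w - d q a\<bar>"]) auto
  qed auto
  moreover have "K \<subseteq> M"
    by (auto simp: K_def)
  ultimately have "K = {} \<or> K = M"
    using X by (auto simp: connected_space_clopen_in closedin_def)
  moreover have "a \<in> K"
    using aM by (auto simp: K_def)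
  moreover have "p \<in> N"
    using p by (auto simp: N_def)
  ultimately show False
    using KN p by blast
qed

end

section \<open>Radial orders on connected spaces that contain a circle\<close>

lemma radial_order_on_Id_on: "radial_order_on X d (Id_on X)"
  by (auto simp: radial_order_on_def order_on_defs refl_on_def ord_gt_def
      intro: transI antisymI)

theorem theorem5:
  fixes X :: "'a set" and d :: "'a \<Rightarrow> 'a \<Rightarrow> real"
  assumes "Metric_space X d"
    and "connected_space (Metric_space.mtopology X d)"
    and "\<exists>S \<subseteq> X. subtopology (Metric_space.mtopology X d) S
           homeomorphic_space top_of_set (sphere (0::complex) 1)"
  shows "\<forall>r. radial_order_on X d r \<longleftrightarrow> r = Id_on X"
proof -
  interpret Metric_space X d
    by (rule assms(1))
  obtain S where S: "S \<subseteq> X"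
      "subtopology mtopology S homeomorphic_space top_of_set (sphere (0::complex) 1)"
    using assms(3) by blast
  then have conn: "connectedin mtopology (S - {y})" and inf: "infinite S" for y
    using circle_copy_no_cut_points[of mtopology S] by auto
  then obtain p where p: "p \<in> S"
    by (metis finite.emptyI ex_in_conv)
  have "r = Id_on X" if rad: "radial_order_on X d r" for r
  proof -
    have rad': "radial_order_on X d (r\<inverse>)"
      by (rule radial_order_on_converse[OF assms(1) rad])
    have "\<not> ord_gt r x p" "\<not> ord_gt (r\<inverse>) x p" for x
      using no_cut_points_imp_maximal[OF _ assms(2) conn inf p] rad rad' by blast+
    then have "\<not> ord_gt r a b" for a b
      using isolated_point_imp_no_strict_pair[OF rad assms(2), of p a b] p S
      unfolding ord_gt_def by blast
    then show ?thesis
      using rad by (auto simp: radial_order_on_def order_on_defs refl_on_def ord_gt_def)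
  qed
  then show ?thesis
    using radial_order_on_Id_on by blast
qed

end
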